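(* Let $A\subseteq\omega^\omega$ be a $\mathsf{W}$-selfdual set. Then there is a map $\psi:\mathscr{P}(\omega)\to[A]_{\mathsf{W}}$ such that for every $X,Y\subseteq\omega$ $$X\subseteq^*Y\iff\psi(X)\leq_{\mathsf{L}(d_1)}\psi(Y).$$ In particular, $(\mathscr{P}(\omega),\subseteq^* )$ embeds into $\mathrm{Deg}_{\boldsymbol{\Delta}^0_1}(\mathsf{L}(d_1))$ (i.e. there is $\psi:\mathscr{P}(\omega)\to\boldsymbol{\Delta}^0_1$ satisfying the displayed equivalence for all $X,Y\subseteq\omega$), and hence $\mathrm{Deg}_{\boldsymbol{\Delta}^0_1}(\mathsf{L}(d_1))$ contains both antichains of size $2^\omega$ (i.e. there is an injection from $2^\omega$ into $\boldsymbol{\Delta}^0_1$ whose values at distinct points are $\leq_{\mathsf{L}(d_1)}$-incomparable) and infinite descending chains.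
   Context: Base theory: $\mathsf{ZF}+\mathsf{DC}(\mathbb{R})$. $\omega^\omega$ is the Baire space with its product topology and standard metric $d(x,y)=0$ if $x=y$ and $d(x,y)=2^{-n}$ if $x\neq y$ and $n$ is least with $x(n)\neq y(n)$. The metric $d_1$ on $\omega^\omega$ is defined by: $d_1(x,y)=0$ if $x=y$; $d_1(x,y)=d(x,y)$ if $x(0)=y(0)$; $d_1(x,y)=2-2^{-(\max\{x(0),y(0)\}-1)}$ if $x(0)\neq y(0)$. $\mathsf{W}$ is the set of continuous functions $\omega^\omega\to\omega^\omega$; $\mathsf{L}(d_1)$ is the set of $f:\omega^\omega\to\omega^\omega$ with $d_1(f(x),f(y))\leq d_1(x,y)$ for all $x,y$. For a set of functions $\mathcal{F}$, $A\leq_{\mathcal{F}}B$ iff $A=f^{-1}(B)$ for some $f\in\mathcal{F}$; $A\equiv_{\mathcal F}B$ iff $A\leq_{\mathcal F}B\leq_{\mathcal F}A$; $[A]_{\mathcal{F}}=\{B\subseteq\omega^\omega: B\equiv_{\mathcal{F}}A\}$. $A$ is $\mathsf{W}$-selfdual if $A\leq_{\mathsf{W}}\omega^\omega\setminus A$. $\boldsymbol{\Delta}^0_1$ is the collection of clopen subsets of $\omega^\omega$, and $\mathrm{Deg}_{\boldsymbol{\Delta}^0_1}(\mathsf{L}(d_1))$ is the set of $\mathsf{L}(d_1)$-degrees $[A]_{\mathsf{L}(d_1)}$ of clopen sets, partially ordered by the order induced by $\leq_{\mathsf{L}(d_1)}$. For $X,Y\subseteq\omega$, $X\subseteq^*Y$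 iff $X\setminus Y$ is finite. $2^\omega$ is the set of infinite binary sequences. *)

theory Defs
  imports "HOL-Analysis.Analysis" "HOL-Library.Equipollence"
begin

text \<open>
  The library topology on \<open>nat \<Rightarrow> nat\<close> is the product of the discrete topologies, so
  \<open>continuous_on UNIV\<close>, \<open>open\<close> and \<open>closed\<close> have their usual meaning for the Baire space.
  The library also equips this type with a metric (\<open>dist\<close>), but that one is a weighted sum
  and differs from the standard metric, which is therefore defined here.
\<close>

type_synonym baire = "nat \<Rightarrow> nat"

definition d_std :: "baire \<Rightarrow> baire \<Rightarrow> real" where
  "d_std x y = (if x = y then 0 else 1 / 2 ^ (LEAST n. x n \<noteq> y n))"

text \<open>
  In the last case the maximum is at least 1, so the subtraction on naturals does not truncate.
\<close>

definition d1 :: "baire \<Rightarrow> baire \<Rightarrow> real" where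
  "d1 x y =
    (if x = y then 0
     else if x 0 = y 0 then d_std x y
     else 2 - 1 / 2 ^ (max (x 0) (y 0) - 1))"

definition W_fun :: "(baire \<Rightarrow> baire) set" where
  "W_fun = {f. continuous_on UNIV f}"

definition L_fun :: "(baire \<Rightarrow> baire \<Rightarrow> real) \<Rightarrow> (baire \<Rightarrow> baire) set" where
  "L_fun \<delta> = {f. \<forall>x y. \<delta> (f x) (f y) \<le> \<delta> x y}"

definition reducible :: "(baire \<Rightarrow> baire) set \<Rightarrow> baire set \<Rightarrow> baire set \<Rightarrow> bool" where
  "reducible F A B \<longleftrightarrow> (\<exists>f\<in>F. A = f -` B)"

definition bireducible :: "(baire \<Rightarrow> baire) set \<Rightarrow> baire set \<Rightarrow> baire set \<Rightarrow> bool" where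
  "bireducible F A B \<longleftrightarrow> reducible F A B \<and> reducible F B A"

definition degree_of :: "(baire \<Rightarrow> baire) set \<Rightarrow> baire set \<Rightarrow> baire set set" where
  "degree_of F A = {B. bireducible F B A}"

definition W_selfdual :: "baire set \<Rightarrow> bool" where
  "W_selfdual A \<longleftrightarrow> reducible W_fun A (- A)"

definition Delta01 :: "baire set set" where
  "Delta01 = {A. open A \<and> closed A}"

definition Deg :: "baire set set \<Rightarrow> (baire \<Rightarrow> baire) set \<Rightarrow> baire set set set" where
  "Deg \<Gamma> F = degree_of F ` \<Gamma>"

definition deg_le :: "(baire \<Rightarrow> baire) set \<Rightarrow> baire set set \<Rightarrow> baire set set \<Rightarrow> bool" where
  "deg_le F a b \<longleftrightarrow> (\<exists>A\<in>a. \<exists>B\<in>b. reducible F A B)"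

definition deg_less :: "(baire \<Rightarrow> baire) set \<Rightarrow> baire set set \<Rightarrow> baire set set \<Rightarrow> bool" where
  "deg_less F a b \<longleftrightarrow> deg_le F a b \<and> a \<noteq> b"

definition almost_subset :: "nat set \<Rightarrow> nat set \<Rightarrow> bool"  (infix "\<subseteq>*" 50) where
  "X \<subseteq>* Y \<longleftrightarrow> finite (X - Y)"

lemma reducible_L_refl: "reducible (L_fun \<delta>) A A"
proof -
  have "(\<lambda>x. x) \<in> L_fun \<delta>" by (simp add: L_fun_def)
  moreover have "A = (\<lambda>x. x) -` A" by simp
  ultimately show ?thesis unfolding reducible_def by blast
qed

lemma reducible_L_trans:
  assumes "reducible (L_fun \<delta>) A B" "reducible (L_fun \<delta>) B C"
  shows "reducible (L_fun \<delta>) A C"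
proof -
  obtain f g where f: "f \<in> L_fun \<delta>" "A = f -` B" and g: "g \<in> L_fun \<delta>" "B = g -` C"
    using assms unfolding reducible_def by blast
  have "g \<circ> f \<in> L_fun \<delta>"
    using f(1) g(1) unfolding L_fun_def mem_Collect_eq comp_def by (meson order_trans)
  moreover have "A = (g \<circ> f) -` C" using f(2) g(2) by auto
  ultimately show ?thesis unfolding reducible_def by blast
qed

text \<open>The order on degrees is independent of the representatives, and it is a partial order.\<close>

lemma deg_le_degree_of:
  "deg_le (L_fun \<delta>) (degree_of (L_fun \<delta>) A) (degree_of (L_fun \<delta>) B) \<longleftrightarrow> reducible (L_fun \<delta>) A B"
  unfolding deg_le_def degree_of_def bireducible_def
  by (blast intro: reducible_L_refl reducible_L_trans)

lemma degree_of_eq_iff: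
  "degree_of (L_fun \<delta>) A = degree_of (L_fun \<delta>) B \<longleftrightarrow> bireducible (L_fun \<delta>) A B"
  unfolding degree_of_def bireducible_def
  by (blast intro: reducible_L_refl reducible_L_trans)

lemma deg_le_partial_order:
  "partial_order_on (Deg \<Gamma> (L_fun \<delta>))
     {(a, b). a \<in> Deg \<Gamma> (L_fun \<delta>) \<and> b \<in> Deg \<Gamma> (L_fun \<delta>) \<and> deg_le (L_fun \<delta>) a b}"
  unfolding partial_order_on_def preorder_on_def
proof (intro conjI)
  show "trans {(a, b). a \<in> Deg \<Gamma> (L_fun \<delta>) \<and> b \<in> Deg \<Gamma> (L_fun \<delta>) \<and> deg_le (L_fun \<delta>) a b}"
    unfolding trans_def Deg_def by (auto simp: deg_le_degree_of intro: reducible_L_trans)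
  show "antisym {(a, b). a \<in> Deg \<Gamma> (L_fun \<delta>) \<and> b \<in> Deg \<Gamma> (L_fun \<delta>) \<and> deg_le (L_fun \<delta>) a b}"
    unfolding antisym_def
  proof (clarify)
    fix a b assume "a \<in> Deg \<Gamma> (L_fun \<delta>)" "b \<in> Deg \<Gamma> (L_fun \<delta>)" "deg_le (L_fun \<delta>) a b" "deg_le (L_fun \<delta>) b a"
    then show "a = b"
      unfolding Deg_def by (metis imageE deg_le_degree_of degree_of_eq_iff bireducible_def)
  qed
qed (auto simp: refl_on_def Deg_def deg_le_degree_of reducible_L_refl)

end

theory Submission
  imports Defs
begin

text \<open>
  A function is in \<open>L_fun d1\<close> iff it preserves agreement of initial segments and the map \<open>\<phi>\<close> it
  induces on first entries satisfies \<open>max (\<phi> m) (\<phi> n) \<le> max m n\<close> whenever \<open>\<phi> m \<noteq> \<phi> n\<close>; the latter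
  forces \<open>\<phi> n \<le> n\<close> for all large \<open>n\<close>, while below any bound \<open>\<phi>\<close> can be made constant and large.

  Coding a point \<open>x\<close> by the antidiagonals of \<open>x, g x, g (g x), \<dots>\<close> turns a continuous reduction \<open>g\<close>
  of \<open>A\<close> to its complement into a 2-Lipschitz one, at the price of replacing \<open>A\<close> by a Wadge
  equivalent set \<open>B\<close>. In the sum over \<open>n\<close> of copies of \<open>B\<close> that are read only after a delay
  of \<open>u n\<close> entries, the eventual growth of \<open>u\<close> then determines the degree: a reduction that shortens
  a delay by two would yield a contraction mapping \<open>B\<close> to its complement and vice versa, which is
  absurd at its fixed point. Adding 2 to a steep increasing function at the elements of \<open>X\<close> encodes
  \<open>X\<close> modulo finite sets.
\<close>

section \<open>Agreement of initial segments as a basis of the topology\<close>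

definition agree :: "nat \<Rightarrow> baire \<Rightarrow> baire \<Rightarrow> bool" where
  "agree n x y \<longleftrightarrow> (\<forall>i<n. x i = y i)"

lemma agree_mono: "agree n x y \<Longrightarrow> m \<le> n \<Longrightarrow> agree m x y"
  by (auto simp: agree_def)

lemma agree_sym: "agree n x y \<Longrightarrow> agree n y x"
  by (auto simp: agree_def)

lemma agree_trans: "agree n x y \<Longrightarrow> agree n y z \<Longrightarrow> agree n x z"
  by (auto simp: agree_def)

lemma eq_if_agree: "(\<And>n. agree n x y) \<Longrightarrow> x = y"
  by (metis agree_def ext lessI)

subsection \<open>Continuous functions and functions in \<open>L_fun d1\<close>\<close>

lemma open_agree: "open {y. agree n y x}"
proof -
  have "{y. agree n y x} = (\<Inter>i\<in>{..<n}. (\<lambda>y. y i) -` {x i})"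
    by (auto simp: agree_def)
  moreover have "open ((\<lambda>y::baire. y i) -` {x i})" for i
    by (rule open_vimage) (auto intro: continuous_on_product_coordinates simp: open_discrete)
  ultimately show ?thesis by (auto intro!: open_INT)
qed

text \<open>A basic open box restricts only finitely many coordinates, so any bound on those
  coordinates serves as \<open>n\<close>.\<close>

lemma open_contains_agree:
  assumes "open (U :: baire set)" "x \<in> U"
  shows "\<exists>n. \<forall>y. agree n y x \<longrightarrow> y \<in> U"
proof -
  obtain X where X: "x \<in> Pi\<^sub>E UNIV X" "finite {i. X i \<noteq> UNIV}" "Pi\<^sub>E UNIV X \<subseteq> U"
    using product_topology_open_contains_basis[of "\<lambda>_::nat. euclidean :: nat topology" UNIV U x]
      assms by (auto simp: open_fun_def)
  obtain n where n: "\<And>i. X i \<noteq> UNIV \<Longrightarrow> i < n"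
    using X(2) finite_nat_set_iff_bounded by auto
  have "y \<in> Pi\<^sub>E UNIV X" if "agree n y x" for y
    unfolding PiE_UNIV_domain
  proof
    fix i
    show "y i \<in> X i"
      using that n[of i] X(1) by (cases "X i = UNIV") (auto simp: agree_def PiE_iff)
  qed
  then show ?thesis using X(3) by blast
qed

lemma W_fun_iff:
  "f \<in> W_fun \<longleftrightarrow> (\<forall>x n. \<exists>m. \<forall>y. agree m y x \<longrightarrow> f y n = f x n)"
proof
  assume f: "f \<in> W_fun"
  show "\<forall>x n. \<exists>m. \<forall>y. agree m y x \<longrightarrow> f y n = f x n"
  proof (intro allI)
    fix x n
    have "open (f -` {y. agree (Suc n) y (f x)})"
      using f unfolding W_fun_def mem_Collect_eq by (rule open_vimage[OF open_agree])
    moreover have "x \<in> f -` {y. agree (Suc n) y (f x)}" by (simp add: agree_def)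
    ultimately obtain m where "\<forall>y. agree m y x \<longrightarrow> agree (Suc n) (f y) (f x)"
      using open_contains_agree[of "f -` {y. agree (Suc n) y (f x)}" x] by auto
    then show "\<exists>m. \<forall>y. agree m y x \<longrightarrow> f y n = f x n"
      unfolding agree_def by blast
  qed
next
  assume f: "\<forall>x n. \<exists>m. \<forall>y. agree m y x \<longrightarrow> f y n = f x n"
  have "continuous_on UNIV (\<lambda>x. f x n)" for n
    unfolding continuous_on_open_vimage[OF open_UNIV]
  proof (intro allI impI)
    fix B :: "nat set"
    show "open ((\<lambda>x. f x n) -` B \<inter> UNIV)"
    proof (subst open_subopen, intro ballI)
      fix x assume x: "x \<in> (\<lambda>x. f x n) -` B \<inter> UNIV"
      obtain m where "\<And>y. agree m y x \<Longrightarrow> f y n = f x n" using f by blast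
      then have "{y. agree m y x} \<subseteq> (\<lambda>x. f x n) -` B \<inter> UNIV" using x by fastforce
      moreover have "x \<in> {y. agree m y x}" by (simp add: agree_def)
      ultimately show "\<exists>T. open T \<and> x \<in> T \<and> T \<subseteq> (\<lambda>x. f x n) -` B \<inter> UNIV"
        using open_agree by blast
    qed
  qed
  then show "f \<in> W_fun"
    unfolding W_fun_def mem_Collect_eq by (rule continuous_on_coordinatewise_then_product)
qed

lemma W_fun_comp: "f \<in> W_fun \<Longrightarrow> g \<in> W_fun \<Longrightarrow> (\<lambda>x. f (g x)) \<in> W_fun"
  unfolding W_fun_def mem_Collect_eq by (erule continuous_on_compose2) auto

lemma W_fun_agree:
  assumes "f \<in> W_fun"
  shows "\<exists>m. \<forall>y. agree m y x \<longrightarrow> agree n (f y) (f x)"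
proof -
  have "open (f -` {y. agree n y (f x)})"
    using assms unfolding W_fun_def mem_Collect_eq by (rule open_vimage[OF open_agree])
  moreover have "x \<in> f -` {y. agree n y (f x)}" by (simp add: agree_def)
  ultimately show ?thesis
    using open_contains_agree[of "f -` {y. agree n y (f x)}" x] by auto
qed

lemma reducible_W_trans:
  assumes "reducible W_fun A B" "reducible W_fun B C"
  shows "reducible W_fun A C"
proof -
  obtain f g where fg: "f \<in> W_fun" "A = f -` B" "g \<in> W_fun" "B = g -` C"
    using assms unfolding reducible_def by blast
  have "A = (\<lambda>x. g (f x)) -` C" using fg by auto
  then show ?thesis unfolding reducible_def using W_fun_comp[OF fg(3,1)] by blast
qed

section \<open>The metrics in terms of agreement and first entries\<close>

lemma neq_at_Least:
  assumes "x \<noteq> (y :: baire)"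
  shows "x (LEAST i. x i \<noteq> y i) \<noteq> y (LEAST i. x i \<noteq> y i)"
proof -
  have "\<exists>i. x i \<noteq> y i" using assms by auto
  then show ?thesis by (rule LeastI_ex)
qed

lemma d_std_le_iff: "d_std x y \<le> 1 / 2 ^ n \<longleftrightarrow> agree n x y"
proof (cases "x = y")
  case False
  let ?L = "LEAST i. x i \<noteq> y i"
  have L: "x ?L \<noteq> y ?L" using False by (rule neq_at_Least)
  have "n \<le> ?L \<longleftrightarrow> agree n x y"
  proof
    assume "n \<le> ?L"
    then show "agree n x y"
      unfolding agree_def using not_less_Least[of _ "\<lambda>i. x i \<noteq> y i"] by (meson less_le_trans)
  next
    assume "agree n x y"
    then show "n \<le> ?L" using L unfolding agree_def by (meson not_le)
  qed
  then show ?thesis using False by (simp add: d_std_def field_simps)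
qed (simp_all add: d_std_def agree_def)

lemma d1_neq_ge: "x 0 \<noteq> y 0 \<Longrightarrow> d1 x y \<ge> 1"
  by (auto simp: d1_def field_simps)

text \<open>A radius below 1 forces equal first entries, and there \<open>d1\<close> is
  \<open>d_std\<close>. Radius 1 is left out: \<open>agree 0\<close> always holds, but
  \<open>d1\<close> takes values above 1.\<close>

lemma d1_le_iff: "d1 x y \<le> 1 / 2 ^ Suc n \<longleftrightarrow> agree (Suc n) x y"
proof (cases "x 0 = y 0")
  case True
  then have "d1 x y = d_std x y" by (auto simp: d1_def d_std_def)
  then show ?thesis by (simp only: d_std_le_iff)
next
  case False
  have "1 / 2 ^ Suc n < (1::real)" using one_less_power[of "2::real" "Suc n"] by simp
  then have "\<not> d1 x y \<le> 1 / 2 ^ Suc n" using d1_neq_ge[of x y] False by linarith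
  then show ?thesis using False by (auto simp: agree_def)
qed

lemma d1_le_d1_iff_max:
  assumes "x 0 \<noteq> y 0" "x' 0 \<noteq> y' 0"
  shows "d1 x y \<le> d1 x' y' \<longleftrightarrow> max (x 0) (y 0) \<le> max (x' 0) (y' 0)"
proof -
  have "d1 x y \<le> d1 x' y' \<longleftrightarrow> max (x 0) (y 0) - 1 \<le> max (x' 0) (y' 0) - 1"
    using assms by (auto simp: d1_def field_simps)
  \<comment> \<open>Distinct first entries have maximum at least 1, so subtracting 1 loses
    nothing.\<close>
  also have "\<dots> \<longleftrightarrow> max (x 0) (y 0) \<le> max (x' 0) (y' 0)" using assms by auto
  finally show ?thesis .
qed

text \<open>Pairs with equal first entries yield the first condition, pairs whose images have
  distinct first entries the second. If distinct first entries get equal images, the distance drops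
  from at least 1 to at most 1/2, so nothing is demanded.\<close>

lemma L_fun_d1_iff:
  "f \<in> L_fun d1 \<longleftrightarrow>
    (\<forall>n x y. agree n x y \<longrightarrow> agree n (f x) (f y)) \<and>
    (\<forall>x y. f x 0 \<noteq> f y 0 \<longrightarrow> max (f x 0) (f y 0) \<le> max (x 0) (y 0))"
proof
  assume f: "f \<in> L_fun d1"
  have le: "d1 (f x) (f y) \<le> d1 x y" for x y using f by (simp add: L_fun_def)
  have ag: "agree n (f x) (f y)" if "agree n x y" for n x y
  proof (cases n)
    case (Suc m)
    have "d1 x y \<le> 1 / 2 ^ Suc m" using that unfolding Suc d1_le_iff .
    with le[of x y] have "d1 (f x) (f y) \<le> 1 / 2 ^ Suc m" by linarith
    then show ?thesis unfolding Suc d1_le_iff .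
  qed (simp add: agree_def)
  have "max (f x 0) (f y 0) \<le> max (x 0) (y 0)" if "f x 0 \<noteq> f y 0" for x y
  proof -
    have "x 0 \<noteq> y 0" using ag[of 1 x y] that by (auto simp: agree_def)
    then show ?thesis using d1_le_d1_iff_max that le by blast
  qed
  with ag show "(\<forall>n x y. agree n x y \<longrightarrow> agree n (f x) (f y)) \<and>
    (\<forall>x y. f x 0 \<noteq> f y 0 \<longrightarrow> max (f x 0) (f y 0) \<le> max (x 0) (y 0))" by blast
next
  assume f: "(\<forall>n x y. agree n x y \<longrightarrow> agree n (f x) (f y)) \<and>
    (\<forall>x y. f x 0 \<noteq> f y 0 \<longrightarrow> max (f x 0) (f y 0) \<le> max (x 0) (y 0))"
  have "d1 (f x) (f y) \<le> d1 x y" for x y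
  proof (cases "x 0 = y 0")
    case True
    show ?thesis
    proof (cases "x = y")
      case False
      let ?L = "LEAST i. x i \<noteq> y i"
      have "x ?L \<noteq> y ?L" using False by (rule neq_at_Least)
      then obtain m where m: "?L = Suc m" using True by (metis not0_implies_Suc)
      have d: "d1 x y = 1 / 2 ^ Suc m" using True False m by (simp add: d1_def d_std_def)
      then have "agree (Suc m) (f x) (f y)" using f d1_le_iff[of x y m] by simp
      then show ?thesis using d d1_le_iff[of "f x" "f y" m] by simp
    qed (simp add: d1_def)
  next
    case False
    show ?thesis
    proof (cases "f x 0 = f y 0")
      case True
      then have "d1 (f x) (f y) \<le> 1 / 2 ^ Suc 0" unfolding d1_le_iff by (simp add: agree_def)
      then show ?thesis using d1_neq_ge[of x y] False by simp
    next
      case False2: False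
      then show ?thesis using d1_le_d1_iff_max[of "f x" "f y" x y] False f by blast
    qed
  qed
  then show "f \<in> L_fun d1" by (simp add: L_fun_def)
qed

subsection \<open>Delayed sums\<close>

text \<open>The Banach iteration: after \<open>m\<close> steps the first \<open>m\<close> entries no
  longer depend on the starting point.\<close>

lemma contraction_fixpoint:
  assumes h: "\<And>m x y. agree m x y \<Longrightarrow> agree (Suc m) (h x) (h y)"
  shows "\<exists>z. h z = z"
proof -
  have it: "agree m ((h ^^ m) x) ((h ^^ m) y)" for m x y
    by (induction m) (auto simp: h, simp add: agree_def)
  \<comment> \<open>Entry \<open>i\<close> is read off the iterate \<open>Suc i\<close>, where it is
    already independent of the start; hence the arbitrary starting point 0.\<close>
  define z where "z = (\<lambda>i. (h ^^ Suc i) (\<lambda>_. 0) i)"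
  have z: "agree m z ((h ^^ m) b)" for m b
    unfolding agree_def
  proof (intro allI impI)
    fix i assume "i < m"
    then have "(h ^^ m) b = (h ^^ Suc i) ((h ^^ (m - Suc i)) b)"
      by (metis Suc_leI add_diff_inverse_nat comp_apply funpow_add not_less)
    then show "z i = (h ^^ m) b i"
      using it[of "Suc i"] by (simp add: z_def agree_def del: funpow.simps)
  qed
  have "agree m (h z) z" for m
    using h[OF z[of m z]] z[of "Suc m" z]
    by (metis agree_mono agree_sym agree_trans funpow.simps(2) comp_apply le_SucI order_refl)
  then show ?thesis by (blast intro: eq_if_agree)
qed

definition delayed_sum :: "(nat \<Rightarrow> nat) \<Rightarrow> baire set \<Rightarrow> baire set" where
  "delayed_sum u A = {x. (\<lambda>i. x (Suc (i + u (x 0)))) \<in> A}"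

definition delay_code :: "nat \<Rightarrow> nat \<Rightarrow> baire \<Rightarrow> baire" where
  "delay_code n k y =
    (\<lambda>i. case i of 0 \<Rightarrow> n | Suc j \<Rightarrow> if j < k then 0 else y (j - k))"

lemma delay_code_0 [simp]: "delay_code n k y 0 = n"
  by (simp add: delay_code_def)

lemma delay_code_Suc: "delay_code n k y (Suc j) = (if j < k then 0 else y (j - k))"
  by (simp add: delay_code_def)

lemma delay_code_in_delayed_sum: "delay_code n (u n) y \<in> delayed_sum u A \<longleftrightarrow> y \<in> A"
  by (simp add: delayed_sum_def delay_code_Suc)

lemma agree_delay_code:
  assumes "agree m x y"
  shows "agree (Suc (m + k)) (delay_code n k x) (delay_code n k y)"
  using assms by (auto simp: agree_def delay_code_def split: nat.split)

text \<open>The position to be read depends only on \<open>x 0\<close>, so reading is continuous;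
  conversely, summand 0 alone already contains a copy of \<open>A\<close>.\<close>

lemma bireducible_delayed_sum: "bireducible W_fun (delayed_sum u A) A"
  unfolding bireducible_def reducible_def
proof
  have "(\<lambda>x i. x (Suc (i + u (x 0)))) \<in> W_fun"
    unfolding W_fun_iff
  proof (intro allI)
    fix x :: baire and n
    show "\<exists>m. \<forall>y. agree m y x \<longrightarrow> y (Suc (n + u (y 0))) = x (Suc (n + u (x 0)))"
      by (rule exI[of _ "Suc (Suc (n + u (x 0)))"]) (auto simp: agree_def)
  qed
  then show "\<exists>f\<in>W_fun. delayed_sum u A = f -` A"
    by (intro bexI[of _ "\<lambda>x i. x (Suc (i + u (x 0)))"]) (auto simp: delayed_sum_def)
  have "delay_code 0 (u 0) \<in> W_fun"
    unfolding W_fun_iff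
  proof (intro allI)
    fix x n
    have "delay_code 0 (u 0) y n = delay_code 0 (u 0) x n" if "agree n y x" for y
      using agree_delay_code[OF that, of "u 0" 0] by (simp add: agree_def)
    then show "\<exists>m. \<forall>y. agree m y x \<longrightarrow> delay_code 0 (u 0) y n = delay_code 0 (u 0) x n" by blast
  qed
  then show "\<exists>f\<in>W_fun. A = f -` delayed_sum u A"
    by (intro bexI[of _ "delay_code 0 (u 0)"]) (auto simp: delay_code_in_delayed_sum)
qed

text \<open>Summands below \<open>N\<close> are merged into summand \<open>N\<close>, the others
  stay in place. If two images have distinct first entries, one exceeds \<open>N\<close>, so the
  maximum is unchanged.\<close>

lemma delayed_sum_reducible:
  assumes "mono u" and le: "\<And>n. n \<ge> N \<Longrightarrow> u n \<le> v n"
  shows "reducible (L_fun d1) (delayed_sum u A) (delayed_sum v A)"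
proof -
  define \<phi> where "\<phi> n = max n N" for n
  \<comment> \<open>The original delay is kept and only the missing entries are padded; by
    \<open>uv\<close> below the subtraction does not truncate.\<close>
  define f where "f x = delay_code (\<phi> (x 0)) (v (\<phi> (x 0)) - u (x 0)) (\<lambda>i. x (Suc i))" for x
  have uv: "u n \<le> v (\<phi> n)" for n
    using le[of "\<phi> n"] monoD[OF \<open>mono u\<close>, of n "\<phi> n"] by (simp add: \<phi>_def)
  have "agree n (f x) (f y)" if "agree n x y" for n x y
  proof (cases n)
    case (Suc m)
    have x0: "x 0 = y 0" and "agree m (\<lambda>i. x (Suc i)) (\<lambda>i. y (Suc i))"
      using that Suc by (auto simp: agree_def)
    then have "agree (Suc (m + (v (\<phi> (x 0)) - u (x 0)))) (f x) (f y)"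
      unfolding f_def x0[symmetric] by (intro agree_delay_code)
    then show ?thesis by (rule agree_mono) (simp add: Suc)
  qed (simp add: agree_def)
  moreover have "max (f x 0) (f y 0) \<le> max (x 0) (y 0)" if "f x 0 \<noteq> f y 0" for x y
    using that by (auto simp: f_def \<phi>_def max_def split: if_splits)
  ultimately have "f \<in> L_fun d1" by (simp add: L_fun_d1_iff)
  moreover have "delayed_sum u A = f -` delayed_sum v A"
  proof -
    have "(\<lambda>i. f x (Suc (i + v (\<phi> (x 0))))) = (\<lambda>i. x (Suc (i + u (x 0))))" for x
      using uv[of "x 0"] by (auto simp: f_def delay_code_Suc fun_eq_iff)
    then show ?thesis by (auto simp: delayed_sum_def) (auto simp: f_def)
  qed
  ultimately show ?thesis unfolding reducible_def by blast
qed

text \<open>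
  A reduction that shortens the delay by at least two on some cylinder, composed with \<open>g\<close>,
  would be a contraction; its fixed point would lie both in \<open>A\<close> and in its complement.
\<close>
lemma delayed_sum_reducible_imp:
  assumes g: "\<And>m x y. agree (Suc m) x y \<Longrightarrow> agree m (g x) (g y)"
    and gA: "\<And>x. x \<in> A \<longleftrightarrow> g x \<notin> A"
    and "mono v" and ev: "\<And>n. even (u n)" "\<And>n. even (v n)"
    and red: "reducible (L_fun d1) (delayed_sum u A) (delayed_sum v A)"
  shows "\<exists>N. \<forall>n\<ge>N. u n \<le> v n"
proof -
  obtain f where f: "f \<in> L_fun d1" and fS: "delayed_sum u A = f -` delayed_sum v A"
    using red unfolding reducible_def by blast
  have fag: "agree n (f x) (f y)" if "agree n x y" for n x y
    using f that by (simp add: L_fun_d1_iff)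
  have fmax: "max (f x 0) (f y 0) \<le> max (x 0) (y 0)" if "f x 0 \<noteq> f y 0" for x y
    using f that by (simp add: L_fun_d1_iff)
  define \<phi> where "\<phi> n = f (\<lambda>_. n) 0" for n
  have f0: "f x 0 = \<phi> (x 0)" for x
    using fag[of 1 x "\<lambda>_. x 0"] by (simp add: agree_def \<phi>_def)
  have \<phi>max: "max (\<phi> m) (\<phi> n) \<le> max m n" if "\<phi> m \<noteq> \<phi> n" for m n
    using fmax[of "\<lambda>_. m" "\<lambda>_. n"] that by (simp add: \<phi>_def)
  \<comment> \<open>If \<open>\<phi> m > m\<close>, then \<open>k = \<phi> m\<close> works: for
    \<open>n\<close> beyond it, either \<open>\<phi> n = \<phi> m\<close>, or the maximum condition
    for \<open>m\<close> and \<open>n\<close> bounds \<open>\<phi> n\<close> by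
    \<open>n\<close>.\<close>
  obtain k where k: "\<And>n. n \<ge> k \<Longrightarrow> \<phi> n \<le> n"
  proof (cases "\<forall>n. \<phi> n \<le> n")
    case False
    then obtain m where m: "\<phi> m > m" by (auto simp: not_le)
    show ?thesis
    proof (rule that[of "\<phi> m"])
      fix n assume "n \<ge> \<phi> m"
      then show "\<phi> n \<le> n" using \<phi>max[of m n] m by (cases "\<phi> m = \<phi> n") auto
    qed
  qed (use that in blast)
  have "u n \<le> v n" if "n \<ge> k" for n
  proof (rule ccontr)
    assume "\<not> u n \<le> v n"
    moreover have "v (\<phi> n) \<le> v n" using k[OF that] \<open>mono v\<close> by (rule monoD[rotated])
    \<comment> \<open>Parity upgrades the strict inequality to a gap of 2.\<close>
    ultimately have gt: "u n \<ge> v (\<phi> n) + 2" using ev(1)[of n] ev(2)[of "\<phi> n"] by presburger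
    define h where "h y = (\<lambda>i. f (delay_code n (u n) (g y)) (Suc (i + v (\<phi> n))))" for y
    have hA: "y \<in> A \<longleftrightarrow> h y \<notin> A" for y
    proof -
      have "g y \<in> A \<longleftrightarrow> f (delay_code n (u n) (g y)) \<in> delayed_sum v A"
        using fS delay_code_in_delayed_sum by blast
      also have "\<dots> \<longleftrightarrow> h y \<in> A" by (simp add: delayed_sum_def h_def f0)
      finally show ?thesis using gA by blast
    qed
    have contr: "agree (Suc m) (h x) (h y)" if "agree m x y" for m x y
    proof -
      \<comment> \<open>\<open>g\<close> loses at most one entry of agreement and the difference of
        the delays regains at least two, a net gain of one. For \<open>m = 0\<close> the subtraction
        truncates and nothing is lost.\<close>
      have "agree (m - 1) (g x) (g y)" using that g by (cases m) (auto simp: agree_def)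
      then have "agree (Suc (m - 1 + u n))
          (f (delay_code n (u n) (g x))) (f (delay_code n (u n) (g y)))"
        by (intro fag agree_delay_code)
      then show ?thesis using gt by (auto simp: agree_def h_def)
    qed
    obtain z where "h z = z" using contraction_fixpoint[of h] contr by blast
    then show False using hA[of z] by simp
  qed
  then show ?thesis by blast
qed

subsection \<open>Making the selfduality witness 2-Lipschitz\<close>

text \<open>
  The \<open>n\<close>-th entry of the code of \<open>x\<close> is the list of the \<open>(g ^^ i) x (n - i)\<close>, \<open>i \<le> n\<close>, so that
  entry \<open>n\<close> of the code of \<open>g x\<close> is the tail of entry \<open>n + 1\<close> of the code of \<open>x\<close>.
\<close>
definition diag_code :: "(baire \<Rightarrow> baire) \<Rightarrow> baire \<Rightarrow> baire" where
  "diag_code g x = (\<lambda>n. to_nat (map (\<lambda>i. (g ^^ i) x (n - i)) [0..<Suc n]))"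

definition diag_decode :: "baire \<Rightarrow> baire" where
  "diag_decode z = (\<lambda>n. hd (from_nat (z n)))"

definition diag_shift :: "baire \<Rightarrow> baire" where
  "diag_shift z = (\<lambda>n. to_nat (tl (from_nat (z (Suc n)) :: nat list)))"

lemma diag_decode_code [simp]: "diag_decode (diag_code g x) = x"
  by (simp add: diag_decode_def diag_code_def hd_map upt_conv_Cons del: upt_Suc)

lemma diag_shift_code: "diag_shift (diag_code g x) = diag_code g (g x)"
proof
  fix n
  have "tl (map (\<lambda>i. (g ^^ i) x (Suc n - i)) [0..<Suc (Suc n)])
      = map (\<lambda>i. (g ^^ i) (g x) (n - i)) [0..<Suc n]"
    by (rule nth_equalityI) (auto simp: nth_tl funpow_swap1 simp del: upt_Suc)
  then show "diag_shift (diag_code g x) n = diag_code g (g x) n"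
    by (simp add: diag_shift_def diag_code_def del: upt_Suc)
qed

text \<open>Entry \<open>n\<close> involves only the iterates up to \<open>n\<close>, so the maximum
  of finitely many moduli of continuity suffices.\<close>

lemma diag_code_W_fun:
  assumes "g \<in> W_fun"
  shows "diag_code g \<in> W_fun"
  unfolding W_fun_iff
proof (intro allI)
  fix x n
  have gi: "(g ^^ i) \<in> W_fun" for i
  proof (induction i)
    case 0
    show ?case by (simp add: W_fun_def id_def)
  next
    case (Suc i)
    show ?case using W_fun_comp[OF assms Suc] by (simp add: comp_def)
  qed
  have "\<forall>i. \<exists>m. \<forall>y. agree m y x \<longrightarrow> (g ^^ i) y (n - i) = (g ^^ i) x (n - i)"
    using gi W_fun_iff by blast
  then obtain m where m: "\<And>i y. agree (m i) y x \<Longrightarrow> (g ^^ i) y (n - i) = (g ^^ i) x (n - i)"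
    by metis
  have "diag_code g y n = diag_code g x n" if y: "agree (Max (m ` {..n})) y x" for y
  proof -
    have "(g ^^ i) y (n - i) = (g ^^ i) x (n - i)" if "i \<le> n" for i
      using that by (intro m agree_mono[OF y]) auto
    then have "map (\<lambda>i. (g ^^ i) y (n - i)) [0..<Suc n] = map (\<lambda>i. (g ^^ i) x (n - i)) [0..<Suc n]"
      by (intro map_cong) auto
    then show ?thesis unfolding diag_code_def by (rule arg_cong)
  qed
  then show "\<exists>m. \<forall>y. agree m y x \<longrightarrow> diag_code g y n = diag_code g x n" by blast
qed

text \<open>Decoding works entry by entry, so if codes approximate \<open>z\<close>, the decoded
  points approximate \<open>diag_decode z\<close>; continuity of \<open>diag_code g\<close> passes
  to the limit. Hence the range is closed.\<close>

lemma closed_range_diag_code: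
  assumes "g \<in> W_fun" and ap: "\<And>n. \<exists>x. agree n (diag_code g x) z"
  shows "diag_code g (diag_decode z) = z"
proof (rule eq_if_agree)
  fix n
  obtain m where m: "\<And>y. agree m y (diag_decode z) \<Longrightarrow>
      agree n (diag_code g y) (diag_code g (diag_decode z))"
    using W_fun_agree[OF diag_code_W_fun[OF assms(1)]] by blast
  obtain x where x: "agree (max m n) (diag_code g x) z" using ap by blast
  have "agree m (diag_decode (diag_code g x)) (diag_decode z)"
    using x by (auto simp: agree_def diag_decode_def)
  then have "agree n (diag_code g x) (diag_code g (diag_decode z))" using m by simp
  then show "agree n (diag_code g (diag_decode z)) z"
    using x by (meson agree_mono agree_sym agree_trans max.cobounded2)
qed

text \<open>The classical retraction onto a nonempty closed set, here without loss of agreement. It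
  serves to extend maps defined on codes only to the whole space.\<close>

lemma lipschitz_retraction:
  assumes closed: "\<And>z. \<forall>n. \<exists>x\<in>F. agree n x z \<Longrightarrow> z \<in> F" and "F \<noteq> {}"
  shows "\<exists>r. (\<forall>z. r z \<in> F) \<and> (\<forall>z\<in>F. r z = z) \<and>
    (\<forall>n y z. agree n y z \<longrightarrow> agree n (r y) (r z))"
proof -
  \<comment> \<open>the point is retracted to a choice depending only on the longest prefix shared with \<open>F\<close>\<close>
  define exit where "exit z = (LEAST n. \<not> (\<exists>x\<in>F. agree (Suc n) x z))" for z
  define r where "r z = (if z \<in> F then z else SOME x. x \<in> F \<and> agree (exit z) x z)" for z
  have approx: "\<exists>x\<in>F. agree n x z" if "n \<le> exit z" for n z
  proof (cases n)
    case 0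
    then show ?thesis using \<open>F \<noteq> {}\<close> by (auto simp: agree_def)
  next
    case (Suc m)
    then have "m < exit z" using that by simp
    then show ?thesis unfolding Suc exit_def by (blast dest: not_less_Least)
  qed
  have far: "\<not> (\<exists>x\<in>F. agree (Suc (exit z)) x z)" if "z \<notin> F" for z
  proof -
    have "\<not> (\<forall>n. \<exists>x\<in>F. agree n x z)" using closed[of z] that by (rule contrapos_nn[rotated])
    then obtain n where n: "\<not> (\<exists>x\<in>F. agree n x z)" by (auto simp only: not_all)
    then have "\<not> (\<exists>x\<in>F. agree (Suc n) x z)" using agree_mono[of "Suc n" _ z n] by auto
    then show ?thesis unfolding exit_def by (rule LeastI)
  qed
  have r: "r z \<in> F \<and> agree (exit z) (r z) z" if "z \<notin> F" for z
  proof -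
    have "\<exists>x. x \<in> F \<and> agree (exit z) x z" using approx[of "exit z" z] by blast
    then show ?thesis unfolding r_def if_not_P[OF that] by (rule someI_ex)
  qed
  have rF: "r z \<in> F" for z using r by (cases "z \<in> F") (auto simp: r_def)
  \<comment> \<open>Either the first \<open>n\<close> entries of \<open>z\<close> already leave
    \<open>F\<close>, and then \<open>r\<close> is constant on that cylinder (\<open>same\<close>),
    or \<open>r\<close> keeps these entries.\<close>
  have key: "(z \<notin> F \<and> exit z < n) \<or> agree n (r z) z" for n z
    using r[of z] agree_mono[of "exit z" "r z" z n]
    by (cases "z \<in> F") (auto simp: r_def agree_def)
  have same: "r y = r z" if ag: "agree n y z" and z: "z \<notin> F" "exit z < n" for n y z
  proof -
    have eq: "agree k x y \<longleftrightarrow> agree k x z" if "k \<le> n" for k x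
      using ag that by (meson agree_mono agree_sym agree_trans)
    have fy: "\<not> (\<exists>x\<in>F. agree (Suc (exit z)) x y)" using far[OF z(1)] eq[of "Suc (exit z)"] z(2) by simp
    then have "y \<notin> F" by (auto simp: agree_def)
    have "exit y = exit z"
    proof (rule antisym)
      show "exit y \<le> exit z" unfolding exit_def[of y] using fy by (rule Least_le)
      show "exit z \<le> exit y"
      proof (rule ccontr)
        assume "\<not> ?thesis"
        then have "Suc (exit y) \<le> exit z" by simp
        then show False using far[OF \<open>y \<notin> F\<close>] approx[of "Suc (exit y)" z] eq[of "Suc (exit y)"] z(2) by simp
      qed
    qed
    \<comment> \<open>The two \<open>SOME\<close> choices coincide because their predicates are
      equal.\<close>
    then show ?thesis using \<open>y \<notin> F\<close> z eq[of "exit z"] by (simp add: r_def)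
  qed
  have "agree n (r y) (r z)" if ag: "agree n y z" for n y z
  proof (cases "(z \<notin> F \<and> exit z < n) \<or> (y \<notin> F \<and> exit y < n)")
    case True
    then have "r y = r z" using same[OF ag] same[OF agree_sym[OF ag]] by auto
    then show ?thesis by (simp add: agree_def)
  next
    case False
    then show ?thesis using key[of z n] key[of y n] ag by (meson agree_sym agree_trans)
  qed
  then show ?thesis using rF by (intro exI[of _ r]) (auto simp: r_def)
qed

text \<open>\<open>B\<close> is the preimage of \<open>A\<close> under retraction to codes followed
  by decoding, a continuous map with right inverse \<open>diag_code g\<close>. The new witness
  retracts, which costs no agreement, and then shifts, which acts as \<open>g\<close> on codes and
  costs one entry.\<close>

lemma selfdual_2_lipschitz:
  assumes "W_selfdual A"
  shows "\<exists>B g. bireducible W_fun B A \<and>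
    (\<forall>m x y. agree (Suc m) x y \<longrightarrow> agree m (g x) (g y)) \<and> (\<forall>x. x \<in> B \<longleftrightarrow> g x \<notin> B)"
proof -
  obtain g where gW: "g \<in> W_fun" and g: "\<And>x. x \<in> A \<longleftrightarrow> g x \<notin> A"
    using assms unfolding W_selfdual_def reducible_def by blast
  have "\<exists>r. (\<forall>z. r z \<in> range (diag_code g)) \<and> (\<forall>z\<in>range (diag_code g). r z = z) \<and>
    (\<forall>n y z. agree n y z \<longrightarrow> agree n (r y) (r z))"
  proof (rule lipschitz_retraction)
    fix z assume "\<forall>n. \<exists>x\<in>range (diag_code g). agree n x z"
    then have "diag_code g (diag_decode z) = z" using closed_range_diag_code[OF gW] by blast
    then show "z \<in> range (diag_code g)" by (metis rangeI)
  qed simp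
  then obtain r where r: "\<And>z. r z \<in> range (diag_code g)" "\<And>x. r (diag_code g x) = diag_code g x"
    "\<And>n y z. agree n y z \<Longrightarrow> agree n (r y) (r z)" by blast
  define p where "p z = diag_decode (r z)" for z
  have pW: "p \<in> W_fun"
    unfolding W_fun_iff
  proof (intro allI)
    fix x n
    have "p y n = p x n" if "agree (Suc n) y x" for y
      using r(3)[OF that] by (simp add: p_def agree_def diag_decode_def)
    then show "\<exists>m. \<forall>y. agree m y x \<longrightarrow> p y n = p x n" by blast
  qed
  have pe: "p (diag_code g x) = x" for x by (simp add: p_def r)
  have ep: "diag_code g (p z) = r z" for z using r(1)[of z] by (auto simp: p_def)
  define B where "B = p -` A"
  have "bireducible W_fun B A"
    unfolding bireducible_def reducible_def
  proof
    show "\<exists>f\<in>W_fun. B = f -` A" using pW B_def by blast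
    show "\<exists>f\<in>W_fun. A = f -` B"
      using diag_code_W_fun[OF gW] by (rule rev_bexI) (auto simp: B_def pe)
  qed
  moreover have "agree m (diag_shift (r x)) (diag_shift (r y))" if "agree (Suc m) x y" for m x y
    using r(3)[OF that] by (auto simp: agree_def diag_shift_def)
  moreover have "x \<in> B \<longleftrightarrow> diag_shift (r x) \<notin> B" for x
    using g[of "p x"] by (simp add: B_def ep[symmetric] diag_shift_code pe)
  ultimately show ?thesis
    by (intro exI[of _ B] exI[of _ "\<lambda>z. diag_shift (r z)"]) blast
qed

subsection \<open>Embedding inclusion modulo finite sets\<close>

text \<open>The slope 4 keeps the function monotone despite the bumps of 2, and all values are even,
  so \<open>\<le>\<close> can only fail by a full 2.\<close>

definition delay_of :: "nat set \<Rightarrow> nat \<Rightarrow> nat" where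
  "delay_of X n = 4 * n + (if n \<in> X then 2 else 0)"

lemma mono_delay_of: "mono (delay_of X)"
  by (rule incseq_SucI) (simp add: delay_of_def)

lemma even_delay_of: "even (delay_of X n)"
  by (simp add: delay_of_def)

lemma delay_of_eventually_le_iff:
  "(\<exists>N. \<forall>n\<ge>N. delay_of X n \<le> delay_of Y n) \<longleftrightarrow> X \<subseteq>* Y"
proof -
  have "delay_of X n \<le> delay_of Y n \<longleftrightarrow> n \<notin> X - Y" for n by (simp add: delay_of_def)
  then show ?thesis
    unfolding almost_subset_def finite_nat_set_iff_bounded by (metis not_le)
qed

lemma almost_subset_embedding:
  assumes "W_selfdual A"
  shows "\<exists>\<psi> :: nat set \<Rightarrow> baire set. (\<forall>X. \<psi> X \<in> degree_of W_fun A) \<and>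
    (\<forall>X Y. X \<subseteq>* Y \<longleftrightarrow> reducible (L_fun d1) (\<psi> X) (\<psi> Y))"
proof -
  obtain B g where B: "bireducible W_fun B A"
    and g: "\<And>m x y. agree (Suc m) x y \<Longrightarrow> agree m (g x) (g y)" "\<And>x. x \<in> B \<longleftrightarrow> g x \<notin> B"
    using selfdual_2_lipschitz[OF assms] by blast
  let ?\<psi> = "\<lambda>X. delayed_sum (delay_of X) B"
  have "?\<psi> X \<in> degree_of W_fun A" for X
    using B bireducible_delayed_sum[of "delay_of X" B] reducible_W_trans
    unfolding degree_of_def bireducible_def by blast
  moreover have "X \<subseteq>* Y \<longleftrightarrow> reducible (L_fun d1) (?\<psi> X) (?\<psi> Y)" for X Y
    unfolding delay_of_eventually_le_iff[symmetric]
  proof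
    assume "\<exists>N. \<forall>n\<ge>N. delay_of X n \<le> delay_of Y n"
    then show "reducible (L_fun d1) (?\<psi> X) (?\<psi> Y)"
      using delayed_sum_reducible[OF mono_delay_of] by blast
  next
    assume "reducible (L_fun d1) (?\<psi> X) (?\<psi> Y)"
    with g mono_delay_of even_delay_of even_delay_of
    show "\<exists>N. \<forall>n\<ge>N. delay_of X n \<le> delay_of Y n"
      by (rule delayed_sum_reducible_imp)
  qed
  ultimately show ?thesis by (intro exI[of _ ?\<psi>]) blast
qed

section \<open>Clopen sets, antichains and descending chains\<close>

lemma almost_subset_embedding_Delta01:
  "\<exists>\<psi> :: nat set \<Rightarrow> baire set. (\<forall>X. \<psi> X \<in> Delta01) \<and>
    (\<forall>X Y. X \<subseteq>* Y \<longleftrightarrow> reducible (L_fun d1) (\<psi> X) (\<psi> Y))"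
proof -
  let ?A = "{x :: baire. x 0 = 0}"
  have vim: "open (f -` {x. P (x 0)})" if "f \<in> W_fun" for f and P :: "nat \<Rightarrow> bool"
  proof -
    have "continuous_on UNIV (\<lambda>x. f x 0)"
      using that unfolding W_fun_def
      by (auto intro: continuous_on_compose2[OF continuous_on_product_coordinates])
    then have "open ((\<lambda>x. f x 0) -` Collect P)" by (intro open_vimage) (auto simp: open_discrete)
    then show ?thesis by (simp add: vimage_def)
  qed
  \<comment> \<open>Every set in the Wadge degree of \<open>?A\<close> is such a preimage, so the
    general embedding applied to \<open>?A\<close> has only clopen values.\<close>
  have clopen: "f -` ?A \<in> Delta01" if "f \<in> W_fun" for f
    using vim[OF that, of "\<lambda>k. k = 0"] vim[OF that, of "\<lambda>k. k \<noteq> 0"]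
    by (simp add: Delta01_def closed_def Compl_eq vimage_def)
  have "W_selfdual ?A"
    unfolding W_selfdual_def reducible_def
  proof (rule bexI)
    show "(\<lambda>x _. if x 0 = 0 then 1 else 0) \<in> W_fun"
      unfolding W_fun_iff by (intro allI exI[of _ 1]) (auto simp: agree_def)
  qed (auto split: if_splits)
  then obtain \<psi> :: "nat set \<Rightarrow> baire set" where \<psi>: "\<And>X. \<psi> X \<in> degree_of W_fun ?A"
    "\<forall>X Y. X \<subseteq>* Y \<longleftrightarrow> reducible (L_fun d1) (\<psi> X) (\<psi> Y)"
    using almost_subset_embedding by blast
  have "\<psi> X \<in> Delta01" for X
    using \<psi>(1)[of X] clopen unfolding degree_of_def bireducible_def reducible_def by auto
  with \<psi>(2) show ?thesis by blast
qed

text \<open>The branch of the binary tree given by \<open>x\<close>, with nodes coded as numbers: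
  the standard almost disjoint family of size continuum.\<close>

definition initial_segments :: "(nat \<Rightarrow> bool) \<Rightarrow> nat set" where
  "initial_segments x = range (\<lambda>n. to_nat (map x [0..<n]))"

text \<open>Once \<open>x\<close> and \<open>y\<close> differ at \<open>k\<close>, no prefix of
  \<open>x\<close> longer than \<open>k\<close> lies on the branch of \<open>y\<close>, and there
  are infinitely many such prefixes.\<close>

lemma initial_segments_not_almost_subset:
  assumes "x \<noteq> y"
  shows "\<not> initial_segments x \<subseteq>* initial_segments y"
proof
  assume "initial_segments x \<subseteq>* initial_segments y"
  then have fin: "finite (initial_segments x - initial_segments y)" by (simp add: almost_subset_def)
  obtain k where k: "x k \<noteq> y k" using assms by blast
  let ?c = "\<lambda>n. to_nat (map x [0..<n])"
  have "?c n \<notin> initial_segments y" if "n > k" for n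
  proof
    assume "?c n \<in> initial_segments y"
    then obtain m where eq: "map x [0..<n] = map y [0..<m]" by (auto simp: initial_segments_def)
    then have "n = m" using map_eq_imp_length_eq by fastforce
    then show False using eq k that by auto
  qed
  then have "?c ` {k<..} \<subseteq> initial_segments x - initial_segments y"
    by (auto simp: initial_segments_def)
  moreover have "inj_on ?c {k<..}"
    by (rule inj_onI) (metis length_map length_upt minus_nat.diff_0 to_nat_split)
  ultimately have "finite {k<..}" using finite_subset[OF _ fin] finite_imageD by blast
  then show False by (simp add: infinite_Ioi)
qed

text \<open>Numbers are viewed as pairs; passing from \<open>D n\<close> to \<open>D (Suc n)\<close>
  removes the infinite column \<open>n\<close>.\<close>

lemma almost_subset_descending:
  fixes D :: "nat \<Rightarrow> nat set"
  defines "D \<equiv> \<lambda>n. {k. fst (prod_decode k) \<ge> n}"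
  shows "D (Suc n) \<subseteq>* D n" "\<not> D n \<subseteq>* D (Suc n)"
proof -
  have "D (Suc n) - D n = {}" by (auto simp: D_def)
  then show "D (Suc n) \<subseteq>* D n" unfolding almost_subset_def by (simp only: finite.emptyI)
  have "range (\<lambda>b. prod_encode (n, b)) \<subseteq> D n - D (Suc n)" by (auto simp: D_def)
  moreover have "infinite (range (\<lambda>b. prod_encode (n, b)))"
    by (rule range_inj_infinite) (simp add: inj_def)
  ultimately show "\<not> D n \<subseteq>* D (Suc n)"
    unfolding almost_subset_def by (meson finite_subset)
qed

theorem theorem5p11:
  shows "(\<forall>A. W_selfdual A \<longrightarrow>
      (\<exists>\<psi> :: nat set \<Rightarrow> baire set.
        (\<forall>X. \<psi> X \<in> degree_of W_fun A) \<and>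
        (\<forall>X Y. X \<subseteq>* Y \<longleftrightarrow> reducible (L_fun d1) (\<psi> X) (\<psi> Y))))
    \<and> (\<exists>\<psi> :: nat set \<Rightarrow> baire set.
        (\<forall>X. \<psi> X \<in> Delta01) \<and>
        (\<forall>X Y. X \<subseteq>* Y \<longleftrightarrow> reducible (L_fun d1) (\<psi> X) (\<psi> Y)))
    \<and> (\<exists>\<Psi> :: nat set \<Rightarrow> baire set set.
        (\<forall>X. \<Psi> X \<in> Deg Delta01 (L_fun d1)) \<and>
        (\<forall>X Y. X \<subseteq>* Y \<longleftrightarrow> deg_le (L_fun d1) (\<Psi> X) (\<Psi> Y)))
    \<and> (\<exists>h :: (nat \<Rightarrow> bool) \<Rightarrow> baire set.
        inj h \<and> (\<forall>x. h x \<in> Delta01) \<and>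
        (\<forall>x y. x \<noteq> y \<longrightarrow>
          \<not> reducible (L_fun d1) (h x) (h y) \<and> \<not> reducible (L_fun d1) (h y) (h x)))
    \<and> (\<exists>C \<subseteq> Deg Delta01 (L_fun d1).
        C \<approx> (UNIV :: (nat \<Rightarrow> bool) set) \<and>
        (\<forall>a\<in>C. \<forall>b\<in>C. a \<noteq> b \<longrightarrow> \<not> deg_le (L_fun d1) a b \<and> \<not> deg_le (L_fun d1) b a))
    \<and> (\<exists>c :: nat \<Rightarrow> baire set set.
        (\<forall>n. c n \<in> Deg Delta01 (L_fun d1)) \<and> (\<forall>n. deg_less (L_fun d1) (c (Suc n)) (c n)))"
proof -
  obtain \<psi> :: "nat set \<Rightarrow> baire set" where \<psi>: "\<And>X. \<psi> X \<in> Delta01"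
    "\<And>X Y. X \<subseteq>* Y \<longleftrightarrow> reducible (L_fun d1) (\<psi> X) (\<psi> Y)"
    using almost_subset_embedding_Delta01 by blast
  define \<Psi> where "\<Psi> X = degree_of (L_fun d1) (\<psi> X)" for X
  have \<Psi>: "\<Psi> X \<in> Deg Delta01 (L_fun d1)" "X \<subseteq>* Y \<longleftrightarrow> deg_le (L_fun d1) (\<Psi> X) (\<Psi> Y)" for X Y
    using \<psi> by (auto simp: \<Psi>_def Deg_def deg_le_degree_of)
  \<comment> \<open>Equal values would be comparable by reflexivity; so incomparability yields
    injectivity, and non-inclusion yields distinct degrees along the chain.\<close>
  have refl: "X \<subseteq>* X" for X by (simp add: almost_subset_def)
  let ?I = initial_segments
  have inj: "inj (\<lambda>x. \<psi> (?I x))" "inj (\<lambda>x. \<Psi> (?I x))"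
    using initial_segments_not_almost_subset \<psi>(2) \<Psi>(2) refl unfolding inj_def by metis+
  have "\<exists>h :: (nat \<Rightarrow> bool) \<Rightarrow> baire set.
        inj h \<and> (\<forall>x. h x \<in> Delta01) \<and>
        (\<forall>x y. x \<noteq> y \<longrightarrow>
          \<not> reducible (L_fun d1) (h x) (h y) \<and> \<not> reducible (L_fun d1) (h y) (h x))"
    using inj(1) \<psi> initial_segments_not_almost_subset by (intro exI[of _ "\<lambda>x. \<psi> (?I x)"]) metis
  moreover have "\<exists>C \<subseteq> Deg Delta01 (L_fun d1).
        C \<approx> (UNIV :: (nat \<Rightarrow> bool) set) \<and>
        (\<forall>a\<in>C. \<forall>b\<in>C. a \<noteq> b \<longrightarrow> \<not> deg_le (L_fun d1) a b \<and> \<not> deg_le (L_fun d1) b a)"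
  proof (intro exI[of _ "range (\<lambda>x. \<Psi> (?I x))"] conjI)
    show "range (\<lambda>x. \<Psi> (?I x)) \<approx> (UNIV :: (nat \<Rightarrow> bool) set)"
      using inj(2) by (rule inj_on_image_eqpoll_self)
    show "\<forall>a\<in>range (\<lambda>x. \<Psi> (?I x)). \<forall>b\<in>range (\<lambda>x. \<Psi> (?I x)).
        a \<noteq> b \<longrightarrow> \<not> deg_le (L_fun d1) a b \<and> \<not> deg_le (L_fun d1) b a"
    proof (intro ballI impI)
      fix a b assume "a \<in> range (\<lambda>x. \<Psi> (?I x))" "b \<in> range (\<lambda>x. \<Psi> (?I x))" "a \<noteq> b"
      then obtain x y where "a = \<Psi> (?I x)" "b = \<Psi> (?I y)" "x \<noteq> y" by blast
      then show "\<not> deg_le (L_fun d1) a b \<and> \<not> deg_le (L_fun d1) b a"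
        using initial_segments_not_almost_subset \<Psi>(2) by metis
    qed
  qed (use \<Psi>(1) in blast)
  moreover have "\<exists>c :: nat \<Rightarrow> baire set set.
        (\<forall>n. c n \<in> Deg Delta01 (L_fun d1)) \<and> (\<forall>n. deg_less (L_fun d1) (c (Suc n)) (c n))"
    using \<Psi> almost_subset_descending refl unfolding deg_less_def
    by (intro exI[of _ "\<lambda>n. \<Psi> {k. fst (prod_decode k) \<ge> n}"]) metis
  moreover have "\<exists>\<Psi> :: nat set \<Rightarrow> baire set set.
        (\<forall>X. \<Psi> X \<in> Deg Delta01 (L_fun d1)) \<and>
        (\<forall>X Y. X \<subseteq>* Y \<longleftrightarrow> deg_le (L_fun d1) (\<Psi> X) (\<Psi> Y))"
    using \<Psi> by (intro exI[of _ \<Psi>]) simp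
  ultimately show ?thesis
    using almost_subset_embedding almost_subset_embedding_Delta01 by simp
qed

end
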